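(* Let $\mathcal A$ be a finite set of $m\ge 2$ alternatives, $0<\varphi<1$, and consider Mallows' model with dispersion $\varphi$ and $n=1$. For any $W\in\mathcal L(\mathcal A)$, any $b,c\in\mathcal A$ such that $b\succ_W c$, and any $K$, $$\pi_W(\{V\in\mathcal L(\mathcal A):\mathrm{Borda}_b(V)\ge K\})\ge\pi_W(\{V\in\mathcal L(\mathcal A):\mathrm{Borda}_c(V)\ge K\}).$$
   Context: $\mathcal L(\mathcal A)$ is the set of all linear orders (rankings) over $\mathcal A$; $b\succ_W c$ means $b$ is preferred to $c$ in $W$. The Kendall-tau distance $\mathrm{KT}(V,W)$ is the number of unordered pairs of alternatives on which $V$ and $W$ disagree. Mallows' model with $n=1$: sample space and parameter space $\mathcal L(\mathcal A)$, $\pi_W(V)=\frac1Z\varphi^{\mathrm{KT}(V,W)}$, $Z$ the normalization factor. $\mathrm{Borda}_a(V)$ is the number of alternatives ranked below $a$ in $V$. *)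

theory Defs
  imports "HOL-Probability.Probability_Mass_Function"
begin

text \<open>
  A ranking \<open>V\<close> is a strict linear order, as a relation: \<open>(x, y) \<in> V\<close> means that \<open>x\<close> is
  preferred to \<open>y\<close> in \<open>V\<close>. The inclusion \<open>V \<subseteq> A \<times> A\<close> is needed because
  \<open>strict_linear_order_on\<close> does not restrict the field.
\<close>

definition rankings :: "'a set \<Rightarrow> 'a rel set" where
  "rankings A = {V. V \<subseteq> A \<times> A \<and> strict_linear_order_on A V}"

definition kendall_tau :: "'a set \<Rightarrow> 'a rel \<Rightarrow> 'a rel \<Rightarrow> nat" where
  "kendall_tau A V W = card {{x, y} | x y. x \<in> A \<and> y \<in> A \<and> (x, y) \<in> V \<and> (y, x) \<in> W}"

definition borda :: "'a set \<Rightarrow> 'a \<Rightarrow> 'a rel \<Rightarrow> nat" where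
  "borda A a V = card {x \<in> A. (a, x) \<in> V}"

definition mallows_norm :: "'a set \<Rightarrow> real \<Rightarrow> 'a rel \<Rightarrow> real" where
  "mallows_norm A \<phi> W = (\<Sum>V\<in>rankings A. \<phi> ^ kendall_tau A V W)"

definition mallows_pmf :: "'a set \<Rightarrow> real \<Rightarrow> 'a rel \<Rightarrow> 'a rel pmf" where
  "mallows_pmf A \<phi> W = embed_pmf
     (\<lambda>V. if V \<in> rankings A then \<phi> ^ kendall_tau A V W / mallows_norm A \<phi> W else 0)"

lemma finite_rankings: "finite A \<Longrightarrow> finite (rankings A)"
  by (rule finite_subset[of _ "Pow (A \<times> A)"]) (auto simp: rankings_def)

text \<open>
  For \<open>\<phi> > 0\<close> the weights form a probability mass function, so \<open>embed_pmf\<close> is meaningful.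
\<close>

lemma pmf_mallows:
  assumes "finite A" "0 < \<phi>" "W \<in> rankings A"
  shows "pmf (mallows_pmf A \<phi> W) V =
    (if V \<in> rankings A then \<phi> ^ kendall_tau A V W / mallows_norm A \<phi> W else 0)"
proof -
  let ?f = "\<lambda>V. if V \<in> rankings A then \<phi> ^ kendall_tau A V W / mallows_norm A \<phi> W else 0"
  have fin: "finite (rankings A)"
    using assms(1) by (rule finite_rankings)
  have pos: "0 < mallows_norm A \<phi> W"
    unfolding mallows_norm_def using fin assms(2,3) by (intro sum_pos) auto
  have nonneg: "0 \<le> ?f V" for V
    using pos assms(2) by auto
  have "(\<integral>\<^sup>+V. ennreal (?f V) \<partial>count_space UNIV) = (\<Sum>V\<in>rankings A. ennreal (?f V))"
    using fin by (intro nn_integral_count_space') auto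
  also have "\<dots> = ennreal (\<Sum>V\<in>rankings A. ?f V)"
    using nonneg by (intro sum_ennreal)
  also have "(\<Sum>V\<in>rankings A. ?f V) = 1"
    using pos by (simp flip: sum_divide_distrib mallows_norm_def)
  finally show ?thesis
    unfolding mallows_pmf_def using nonneg by (subst pmf_embed_pmf) auto
qed

end

theory Submission
  imports Defs "HOL-Combinatorics.Transposition"
begin

text \<open>
  Let \<open>\<tau>\<close> be the transposition of \<open>b\<close> and \<open>c\<close>. Exchanging the positions of \<open>b\<close> and \<open>c\<close> in a ranking
  is an involution that interchanges the two Borda scores, so it matches the rankings counted only
  on the right (\<open>c\<close> scores at least \<open>K\<close>, \<open>b\<close> does not) with rankings counted only on the left. A
  ranking of the first kind places \<open>c\<close> above \<open>b\<close>, against \<open>W\<close>; correcting this cannot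
  increase the Kendall-tau distance to \<open>W\<close> (lemma \<open>kendall_tau_le_swap\<close>), and as \<open>\<phi> < 1\<close> it cannot
  decrease the weight. Rankings counted on both sides cancel.

  The monotonicity of the distance rests on the same exchange principle
  (\<open>sum_le_sum_of_exchange\<close>), now applied to pairs of alternatives: the pairs inverted before the
  swap but not after it are matched, by \<open>\<tau>\<close> itself, with pairs inverted after it but not before.
\<close>

lemma sum_le_sum_of_exchange:
  fixes f :: "'a \<Rightarrow> 'b::ordered_comm_monoid_add"
  assumes fin: "finite S" "finite T"
    and inj: "inj_on g (S - T)" and maps: "g ` (S - T) \<subseteq> T - S"
    and le: "\<And>x. x \<in> S - T \<Longrightarrow> f x \<le> f (g x)"
    and nonneg: "\<And>y. y \<in> T - S \<Longrightarrow> 0 \<le> f y"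
  shows "sum f S \<le> sum f T"
proof -
  have "sum f (S - T) \<le> sum (f \<circ> g) (S - T)"
    using le by (auto intro: sum_mono)
  also have "\<dots> = sum f (g ` (S - T))"
    using inj by (simp add: sum.reindex)
  also have "\<dots> \<le> sum f (T - S)"
    using fin maps nonneg by (intro sum_mono2) auto
  finally have "sum f (S \<inter> T) + sum f (S - T) \<le> sum f (S \<inter> T) + sum f (T - S)"
    by (rule add_left_mono)
  then show ?thesis
    using sum.Int_Diff[OF fin(1), of f T] sum.Int_Diff[OF fin(2), of f S]
    by (simp add: Int_commute)
qed

lemma rankingsD:
  assumes "V \<in> rankings A"
  shows "V \<subseteq> A \<times> A"
    and "\<And>x. (x, x) \<notin> V"
    and "\<And>x y. (x, y) \<in> V \<Longrightarrow> (y, x) \<notin> V"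
    and "\<And>x y z. (x, y) \<in> V \<Longrightarrow> (y, z) \<in> V \<Longrightarrow> (x, z) \<in> V"
    and "\<And>x y. x \<in> A \<Longrightarrow> y \<in> A \<Longrightarrow> x \<noteq> y \<Longrightarrow> (x, y) \<in> V \<or> (y, x) \<in> V"
proof -
  have "trans V" and irr: "irrefl V" and tot: "total_on A V" and "V \<subseteq> A \<times> A"
    using assms by (simp_all add: rankings_def strict_linear_order_on_def)
  then show "V \<subseteq> A \<times> A"
    by blast
  show irr': "(x, x) \<notin> V" for x
    using irr by (simp add: irrefl_def)
  show trans': "(x, z) \<in> V" if "(x, y) \<in> V" "(y, z) \<in> V" for x y z
    using \<open>trans V\<close> that by (rule transD)
  show "(y, x) \<notin> V" if "(x, y) \<in> V" for x y
    using trans'[OF that, of x] irr'[of x] by blast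
  show "(x, y) \<in> V \<or> (y, x) \<in> V" if "x \<in> A" "y \<in> A" "x \<noteq> y" for x y
    using tot that by (simp add: total_on_def)
qed

text \<open>
  The definition counts unordered pairs. In a ranking at most one orientation of a pair can occur,
  so counting ordered inversions is the same, and is easier to transport along a permutation.
\<close>

lemma kendall_tau_eq_card_inversions:
  assumes "V \<in> rankings A"
  shows "kendall_tau A V W = card {(x, y). (x, y) \<in> V \<and> (y, x) \<in> W}"
proof -
  have "{{x, y} | x y. x \<in> A \<and> y \<in> A \<and> (x, y) \<in> V \<and> (y, x) \<in> W}
      = (\<lambda>(x, y). {x, y}) ` {(x, y). (x, y) \<in> V \<and> (y, x) \<in> W}"
    using rankingsD(1)[OF assms] by fast
  moreover have "inj_on (\<lambda>(x, y). {x, y}) {(x, y). (x, y) \<in> V \<and> (y, x) \<in> W}"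
    using rankingsD(3)[OF assms] by (auto simp: inj_on_def doubleton_eq_iff)
  ultimately show ?thesis
    by (simp add: kendall_tau_def card_image)
qed

abbreviation exchange :: "'a \<Rightarrow> 'a \<Rightarrow> 'a \<Rightarrow> 'a" where
  "exchange \<equiv> Transposition.transpose"

text \<open>
  A ranking with the positions of \<open>b\<close> and \<open>c\<close> exchanged is the preimage under
  their transposition, which is also the image, as a transposition is its own inverse.
\<close>

abbreviation swap_ranking :: "'a \<Rightarrow> 'a \<Rightarrow> 'a rel \<Rightarrow> 'a rel" where
  "swap_ranking b c V \<equiv> inv_image V (exchange b c)"

lemma swap_ranking_involutory: "swap_ranking b c (swap_ranking b c V) = V"
  by (auto simp: inv_image_def)

lemma exchange_mem_iff:
  assumes "b \<in> A" "c \<in> A"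
  shows "exchange b c x \<in> A \<longleftrightarrow> x \<in> A"
  using assms by (auto simp: Transposition.transpose_def)

lemma swap_ranking_in_rankings:
  assumes "V \<in> rankings A" "b \<in> A" "c \<in> A"
  shows "swap_ranking b c V \<in> rankings A"
proof -
  note V = rankingsD[OF assms(1)]
  have "swap_ranking b c V \<subseteq> A \<times> A"
    using V(1) exchange_mem_iff[OF assms(2,3)] by (auto simp: inv_image_def)
  moreover have "trans (swap_ranking b c V)"
    using assms(1) by (simp add: rankings_def strict_linear_order_on_def trans_inv_image)
  moreover have "irrefl (swap_ranking b c V)"
    using V(2) by (auto simp: irrefl_def inv_image_def)
  moreover have "total_on A (swap_ranking b c V)"
    unfolding total_on_def in_inv_image
    by (intro ballI impI V(5)) (simp_all add: exchange_mem_iff[OF assms(2,3)] inj_eq[OF inj_transpose])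
  ultimately show ?thesis
    by (simp add: rankings_def strict_linear_order_on_def)
qed

lemma borda_swap_ranking:
  assumes "b \<in> A" "c \<in> A"
  shows "borda A a (swap_ranking b c V) = borda A (exchange b c a) V"
proof -
  have "{x \<in> A. (exchange b c a, x) \<in> V}
      = exchange b c ` {x \<in> A. (a, x) \<in> swap_ranking b c V}"
  proof (rule set_eqI)
    fix y
    show "y \<in> {x \<in> A. (exchange b c a, x) \<in> V} \<longleftrightarrow>
        y \<in> exchange b c ` {x \<in> A. (a, x) \<in> swap_ranking b c V}"
      using exchange_mem_iff[OF assms, of y] exchange_mem_iff[OF assms]
      by (auto simp: inv_image_def intro!: image_eqI[where x = "exchange b c y"])
  qed
  then show ?thesis
    by (simp add: borda_def card_image)
qed

lemma borda_less_if_preferred: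
  assumes "finite A" "V \<in> rankings A" "(x, y) \<in> V"
  shows "borda A y V < borda A x V"
proof -
  have "y \<in> A"
    using assms(3) rankingsD(1)[OF assms(2)] by auto
  have "{z \<in> A. (y, z) \<in> V} \<subset> {z \<in> A. (x, z) \<in> V}"
  proof (rule psubsetI)
    show "{z \<in> A. (y, z) \<in> V} \<subseteq> {z \<in> A. (x, z) \<in> V}"
      using rankingsD(4)[OF assms(2,3)] by blast
    show "{z \<in> A. (y, z) \<in> V} \<noteq> {z \<in> A. (x, z) \<in> V}"
      using \<open>y \<in> A\<close> assms(3) rankingsD(2)[OF assms(2), of y] by blast
  qed
  then show ?thesis
    using assms(1) by (simp add: borda_def psubset_card_mono)
qed

text \<open>
  Swapping in \<open>V\<close> produces as many inversions as swapping in \<open>W\<close>, so \<open>V\<close> may be kept and only the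
  requirement from \<open>W\<close> changed. Let \<open>(x, y)\<close> be an inversion that is lost. It involves exactly one
  of \<open>b\<close> and \<open>c\<close>: the pair \<open>{b, c}\<close> is not inverted, and pairs avoiding both are unaffected.
  Let \<open>z\<close> be the other alternative. As \<open>b\<close> is above \<open>c\<close> in \<open>W\<close>, the inversion can only be lost
  if \<open>z\<close> lies between \<open>b\<close> and \<open>c\<close> in \<open>W\<close>, and the pair is \<open>(c, z)\<close> or \<open>(z, b)\<close>.
  As \<open>b\<close> is above \<open>c\<close> in \<open>V\<close>, then \<open>(b, z)\<close> respectively \<open>(z, c)\<close> is in \<open>V\<close>, by transitivity. This
  pair is not an inversion before the swap and is one after it.
\<close>

lemma kendall_tau_le_swap:
  assumes fin: "finite A" and V: "V \<in> rankings A" and W: "W \<in> rankings A"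
    and bA: "b \<in> A" and cA: "c \<in> A" and bcV: "(b, c) \<in> V" and bcW: "(b, c) \<in> W"
  shows "kendall_tau A V W \<le> kendall_tau A (swap_ranking b c V) W"
proof -
  let ?t = "exchange b c"
  let ?g = "map_prod ?t ?t"
  define S where "S = {(x, y). (x, y) \<in> V \<and> (y, x) \<in> W}"
  define T where "T = {(x, y). (x, y) \<in> V \<and> (?t y, ?t x) \<in> W}"
  note V' = rankingsD[OF V] and W' = rankingsD[OF W]
  have inj: "inj ?g"
    by (simp add: prod.inj_map)
  have "finite V"
    using fin V'(1) by (auto intro: finite_subset)
  then have finS: "finite S" and finT: "finite T"
    by (auto simp: S_def T_def intro: finite_subset[where B = V])
  have maps: "?g ` (S - T) \<subseteq> T - S"
  proof (rule image_subsetI)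
    fix p
    assume "p \<in> S - T"
    moreover obtain x y where p: "p = (x, y)"
      by (cases p)
    ultimately have "(x, y) \<in> S" and notT: "(x, y) \<notin> T"
      by auto
    then have xyV: "(x, y) \<in> V" and yxW: "(y, x) \<in> W"
      by (auto simp: S_def)
    from notT xyV have notW: "(?t y, ?t x) \<notin> W"
      by (auto simp: T_def)
    have "x \<in> A" "y \<in> A" "x \<noteq> y"
      using xyV V'(1,2) by auto
    then have txyW: "(?t x, ?t y) \<in> W"
      using W'(5)[of "?t x" "?t y"] notW exchange_mem_iff[OF bA cA]
      by (auto simp: transpose_eq_iff)
    have "(?t x, ?t y) \<in> V"
    proof (cases "x \<in> {b, c} \<and> y \<in> {b, c}")
      case True
      with xyV yxW bcV bcW V'(2,3) W'(3) show ?thesis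
        by auto
    next
      case False
      consider "x = b" "y \<notin> {b, c}" | "x = c" "y \<notin> {b, c}"
        | "y = b" "x \<notin> {b, c}" | "y = c" "x \<notin> {b, c}" | "x \<notin> {b, c}" "y \<notin> {b, c}"
        using False by blast
      then show ?thesis
      proof cases
        case 1
        then have "(y, b) \<in> W" "(c, y) \<in> W"
          using yxW txyW by (simp_all add: Transposition.transpose_def)
        then show ?thesis
          using W'(3)[of c y] W'(4)[of y b c] bcW by blast
      next
        case 2
        then have "(c, y) \<in> V"
          using xyV by simp
        then have "(b, y) \<in> V"
          by (rule V'(4)[OF bcV])
        with 2 show ?thesis
          by (simp add: Transposition.transpose_def)
      next
        case 3
        then have "(x, b) \<in> V"
          using xyV by simp
        then have "(x, c) \<in> V"
          by (rule V'(4)[OF _ bcV])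
        with 3 show ?thesis
          by (simp add: Transposition.transpose_def)
      next
        case 4
        then have "(c, x) \<in> W" "(x, b) \<in> W"
          using yxW txyW by (simp_all add: Transposition.transpose_def)
        then show ?thesis
          using W'(3)[of c x] W'(4)[of x b c] bcW by blast
      next
        case 5
        with xyV show ?thesis
          by (simp add: Transposition.transpose_def)
      qed
    qed
    with yxW notW show "?g p \<in> T - S"
      by (auto simp: p S_def T_def)
  qed
  have "card S \<le> card T"
    using sum_le_sum_of_exchange[OF finS finT inj_on_subset[OF inj subset_UNIV] maps,
        of "\<lambda>_. 1 :: nat"] by simp
  moreover have "{(x, y). (x, y) \<in> swap_ranking b c V \<and> (y, x) \<in> W} = ?g ` T"
    by (force simp: T_def inv_image_def image_iff)
  then have "card {(x, y). (x, y) \<in> swap_ranking b c V \<and> (y, x) \<in> W} = card T"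
    using inj by (simp add: card_image inj_on_subset)
  ultimately show ?thesis
    using V swap_ranking_in_rankings[OF V bA cA]
    by (simp add: kendall_tau_eq_card_inversions S_def)
qed

theorem lemma8:
  fixes A :: "'a set" and \<phi> K :: real and W :: "'a rel" and b c :: 'a
  assumes "finite A" and "card A \<ge> 2"
    and "0 < \<phi>" and "\<phi> < 1"
    and "W \<in> rankings A"
    and "b \<in> A" and "c \<in> A" and "(b, c) \<in> W"
  shows "measure_pmf.prob (mallows_pmf A \<phi> W) {V \<in> rankings A. real (borda A b V) \<ge> K}
       \<ge> measure_pmf.prob (mallows_pmf A \<phi> W) {V \<in> rankings A. real (borda A c V) \<ge> K}"
proof -
  let ?p = "mallows_pmf A \<phi> W"
  let ?s = "swap_ranking b c"
  define S where "S = {V \<in> rankings A. real (borda A c V) \<ge> K}"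
  define T where "T = {V \<in> rankings A. real (borda A b V) \<ge> K}"
  have finS: "finite S" and finT: "finite T"
    using finite_rankings[OF assms(1)] by (auto simp: S_def T_def)
  have inj: "inj_on ?s (S - T)"
    by (rule inj_on_inverseI[where g = ?s]) (rule swap_ranking_involutory)
  have maps: "?s ` (S - T) \<subseteq> T - S"
    using swap_ranking_in_rankings[of _ A b c] borda_swap_ranking[of b A c] assms(6,7)
    by (auto simp: S_def T_def)
  have "pmf ?p V \<le> pmf ?p (?s V)" if V: "V \<in> S - T" for V
  proof -
    have VR: "V \<in> rankings A" and less: "borda A b V < borda A c V"
      using V by (auto simp: S_def T_def)
    have sVR: "?s V \<in> rankings A"
      by (rule swap_ranking_in_rankings[OF VR assms(6,7)])
    have "b \<noteq> c"
      using less by auto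
    moreover have "(b, c) \<notin> V"
      using borda_less_if_preferred[OF assms(1) VR, of b c] less by auto
    ultimately have "(b, c) \<in> ?s V"
      using rankingsD(5)[OF VR assms(6,7)] by (simp add: inv_image_def)
    \<comment> \<open>The distance comparison is applied to the swapped ranking, whose swap is \<open>V\<close>.\<close>
    then have "kendall_tau A (?s V) W \<le> kendall_tau A V W"
      using kendall_tau_le_swap[OF assms(1) sVR assms(5-7) _ assms(8)]
      by (simp only: swap_ranking_involutory)
    then have "\<phi> ^ kendall_tau A V W \<le> \<phi> ^ kendall_tau A (?s V) W"
      using assms(3,4) by (intro power_decreasing) auto
    moreover have "0 \<le> mallows_norm A \<phi> W"
      using assms(3) by (auto simp: mallows_norm_def intro: sum_nonneg)
    ultimately show ?thesis
      using VR sVR pmf_mallows[OF assms(1,3,5)] by (simp add: divide_right_mono)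
  qed
  then have "sum (pmf ?p) S \<le> sum (pmf ?p) T"
    by (intro sum_le_sum_of_exchange[OF finS finT inj maps]) auto
  then show ?thesis
    using finS finT by (simp add: measure_measure_pmf_finite S_def T_def)
qed

end
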